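(* The set $\mathcal{Q}_C(M)$ of $M$-cell quantizers with convex cells is compact under total variation at any input probability measure $P$ on $\mathbb{R}^n$ that is absolutely continuous with respect to the Lebesgue measure on $\mathbb{R}^n$.
   Context: $\mathbb{X}=\mathbb{R}^n$ and $M\ge1$ is an integer. An $M$-cell quantizer is given by a Borel measurable partition $\{B_1,\dots,B_M\}$ of $\mathbb{R}^n$ (some cells $B_i$ may be empty) and is identified with the stochastic kernel $Q$ from $\mathbb{R}^n$ to $\{1,\dots,M\}$ given by $Q(i|x)=1_{\{x\in B_i\}}$. $\mathcal{Q}_C(M)$ is the collection of $M$-cell quantizers all of whose cells are convex subsets of $\mathbb{R}^n$. $PQ$ is the probability measure on $\mathbb{R}^n\times\{1,\dots,M\}$ with $PQ(B\times\{i\})=\int_B Q(i|x)P(dx)$. $Q_n\to Q$ in total variation at input $P$ means $\|PQ_n-PQ\|_{TV}\to0$, where $\|\mu-\nu\|_{TV}=2\sup_A|\mu(A)-\nu(A)|$ over measurable sets $A$. Compact under total variation at input $P$ means that every sequence in the set has a subsequence converging in total variation at input $P$ to an element of the set (convergence being metrizable after identifying $Q,Q'$ with $PQ=PQ'$). *)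

theory Defs
  imports "HOL-Probability.Probability"
begin

(* Cells may be empty, so a partition is a family indexed by {1..M}; the values of B outside
   {1..M} are irrelevant. *)
definition quantizer_partition :: "nat \<Rightarrow> (nat \<Rightarrow> 'a::topological_space set) \<Rightarrow> bool" where
  "quantizer_partition M B \<longleftrightarrow>
     (\<forall>i\<in>{1..M}. B i \<in> sets borel) \<and> disjoint_family_on B {1..M} \<and> (\<Union>i\<in>{1..M}. B i) = UNIV"

definition quantizer_kernel :: "nat \<Rightarrow> (nat \<Rightarrow> 'a set) \<Rightarrow> 'a \<Rightarrow> nat measure" where
  "quantizer_kernel M B x = point_measure {1..M} (\<lambda>i. indicator (B i) x)"

definition convex_quantizers ::
    "nat \<Rightarrow> ('a::{topological_space, real_vector} \<Rightarrow> nat measure) set" where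
  "convex_quantizers M =
     {quantizer_kernel M B | B. quantizer_partition M B \<and> (\<forall>i\<in>{1..M}. convex (B i))}"

(* The joint law PQ of input and output, for a kernel Q into {1..M}: draw x from P, then i from
   Q x.  The formula PQ (A \<times> {i}) = (integral of Q(i|x) over A) is emeasure_joint_law below. *)
definition joint_law ::
    "nat \<Rightarrow> 'a::topological_space measure \<Rightarrow> ('a \<Rightarrow> nat measure) \<Rightarrow> ('a \<times> nat) measure" where
  "joint_law M P Q =
     P \<bind> (\<lambda>x. Q x \<bind> (\<lambda>i. return (borel \<Otimes>\<^sub>M count_space {1..M}) (x, i)))"

(* Intended for finite measures on the same sigma-algebra, where the supremum is over a bounded
   set. *)
definition tv_distance :: "'a measure \<Rightarrow> 'a measure \<Rightarrow> real" where
  "tv_distance \<mu> \<nu> = 2 * (SUP A\<in>sets \<mu>. \<bar>measure \<mu> A - measure \<nu> A\<bar>)"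

definition tv_converges_at ::
    "nat \<Rightarrow> 'a::topological_space measure \<Rightarrow> (nat \<Rightarrow> 'a \<Rightarrow> nat measure) \<Rightarrow> ('a \<Rightarrow> nat measure) \<Rightarrow> bool"
  where
  "tv_converges_at M P Qs Q \<longleftrightarrow>
     (\<lambda>k. tv_distance (joint_law M P (Qs k)) (joint_law M P Q)) \<longlonglongrightarrow> 0"

definition tv_compact_at ::
    "nat \<Rightarrow> 'a::topological_space measure \<Rightarrow> ('a \<Rightarrow> nat measure) set \<Rightarrow> bool" where
  "tv_compact_at M P S \<longleftrightarrow>
     (\<forall>Qs. (\<forall>k. Qs k \<in> S) \<longrightarrow>
        (\<exists>Q\<in>S. \<exists>r::nat \<Rightarrow> nat. strict_mono r \<and> tv_converges_at M P (Qs \<circ> r) Q))"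

lemma emeasure_quantizer_kernel:
  assumes "i \<in> {1..M}"
  shows "emeasure (quantizer_kernel M B x) {i} = indicator (B i) x"
  using assms unfolding quantizer_kernel_def by (subst emeasure_point_measure_finite) auto

lemma quantizer_kernel_stochastic:
  fixes B :: "nat \<Rightarrow> 'a::topological_space set"
  assumes B: "quantizer_partition M B"
  shows "quantizer_kernel M B \<in> borel \<rightarrow>\<^sub>M prob_algebra (count_space {1..M})"
proof (rule measurable_prob_algebraI)
  have tot: "(\<Sum>i\<in>{1..M}. indicator (B i) x :: ennreal) = 1" for x
  proof -
    obtain j where j: "j \<in> {1..M}" "x \<in> B j"
      using B unfolding quantizer_partition_def by blast
    have "indicator (B i) x = (if i = j then 1 else 0 :: ennreal)" if "i \<in> {1..M}" for i
    proof (cases "i = j")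
      case False
      then have "B i \<inter> B j = {}"
        using B j(1) that unfolding quantizer_partition_def disjoint_family_on_def by blast
      then show ?thesis using False j(2) by (auto simp: indicator_def)
    qed (use j in simp)
    then have "(\<Sum>i\<in>{1..M}. indicator (B i) x :: ennreal) = (\<Sum>i\<in>{1..M}. if i = j then 1 else 0)"
      by (intro sum.cong refl) blast
    then show ?thesis using j by simp
  qed
  show prob: "prob_space (quantizer_kernel M B x)" for x
    by (rule prob_spaceI)
       (simp only: quantizer_kernel_def space_point_measure emeasure_point_measure_finite
          finite_atLeastAtMost order_refl tot)
  show "quantizer_kernel M B \<in> borel \<rightarrow>\<^sub>M subprob_algebra (count_space {1..M})"
  proof (rule measurable_subprob_algebra)
    show "subprob_space (quantizer_kernel M B x)" for x
      using prob by (rule prob_space_imp_subprob_space)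
    show "sets (quantizer_kernel M B x) = sets (count_space {1..M})" for x
      by (simp add: quantizer_kernel_def sets_point_measure)
    fix A assume "A \<in> sets (count_space {1..M})"
    then have A: "A \<subseteq> {1..M}" by simp
    have "(\<lambda>x. \<Sum>i\<in>A. indicator (B i) x :: ennreal) \<in> borel_measurable borel"
      using A B unfolding quantizer_partition_def
      by (intro borel_measurable_sum borel_measurable_indicator) auto
    then show "(\<lambda>x. emeasure (quantizer_kernel M B x) A) \<in> borel_measurable borel"
      using A by (simp add: quantizer_kernel_def emeasure_point_measure_finite)
  qed
qed

lemma emeasure_joint_law:
  assumes P: "prob_space P" "sets P = sets borel"
    and Q: "Q \<in> borel \<rightarrow>\<^sub>M prob_algebra (count_space {1..M})"
    and A: "A \<in> sets borel" and i: "i \<in> {1..M}"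
  shows "emeasure (joint_law M P Q) (A \<times> {i}) = (\<integral>\<^sup>+x\<in>A. emeasure (Q x) {i} \<partial>P)"
proof -
  let ?C = "count_space {1..M}" and ?N = "borel \<Otimes>\<^sub>M count_space {1..M}"
  have spP: "space P = UNIV" using sets_eq_imp_space_eq[OF P(2)] by simp
  have Qs: "Q \<in> borel \<rightarrow>\<^sub>M subprob_algebra ?C"
    using Q by (rule measurable_prob_algebraD)
  have sQ: "sets (Q x) = sets ?C" for x
    using Qs by (rule sets_kernel) simp
  have spQ: "space (Q x) = {1..M}" for x
    using sets_eq_imp_space_eq[OF sQ] by simp
  have ret: "(\<lambda>y. return ?N (fst y, snd y)) \<in> borel \<Otimes>\<^sub>M ?C \<rightarrow>\<^sub>M subprob_algebra ?N"
    using return_measurable by simp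
  have inner: "(\<lambda>x. Q x \<bind> (\<lambda>i. return ?N (x, i))) \<in> P \<rightarrow>\<^sub>M subprob_algebra ?N"
    using measurable_bind[OF Qs ret] P(2)
    by (simp cong: measurable_cong_sets)
  have S: "A \<times> {i} \<in> sets ?N" using A i by auto
  have "emeasure (joint_law M P Q) (A \<times> {i})
      = (\<integral>\<^sup>+x. emeasure (Q x \<bind> (\<lambda>i. return ?N (x, i))) (A \<times> {i}) \<partial>P)"
    unfolding joint_law_def using spP by (intro emeasure_bind[OF _ inner S]) auto
  also have "\<dots> = (\<integral>\<^sup>+x\<in>A. emeasure (Q x) {i} \<partial>P)"
  proof (rule nn_integral_cong)
    fix x
    have r: "(\<lambda>i. return ?N (x, i)) \<in> Q x \<rightarrow>\<^sub>M subprob_algebra ?N"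
      using measurable_compose[OF measurable_Pair1'[of x borel ?C] return_measurable]
      unfolding measurable_cong_sets[OF sQ refl] by (simp del: measurable_count_space_eq1)
    have ne: "space (Q x) \<noteq> {}" using i spQ by auto
    have "emeasure (Q x \<bind> (\<lambda>i. return ?N (x, i))) (A \<times> {i})
        = (\<integral>\<^sup>+j. indicator (A \<times> {i}) (x, j) \<partial>Q x)"
      using S by (simp only: emeasure_bind[OF ne r S] emeasure_return)
    also have "\<dots> = (\<integral>\<^sup>+j. indicator A x * indicator {i} j \<partial>Q x)"
      by (intro nn_integral_cong) (auto simp: indicator_def)
    also have "\<dots> = emeasure (Q x) {i} * indicator A x"
      using i sQ by (subst nn_integral_cmult_indicator) (auto simp: mult.commute)
    finally show "emeasure (Q x \<bind> (\<lambda>i. return ?N (x, i))) (A \<times> {i})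
        = emeasure (Q x) {i} * indicator A x" .
  qed
  finally show ?thesis .
qed

end

theory Submission
  imports Defs
begin

text \<open>
  A quantizer is a labelling of the space by finitely many labels, and on the resulting kernels
  total variation is controlled by the probability that two labellings disagree
  (\<open>tv_distance_joint_law_bounds\<close>). Hence it is enough to extract from a sequence of labellings
  with convex fibres a subsequence that converges almost everywhere to a labelling with convex
  Borel fibres; disagreement with the limit then has probability tending to \<open>0\<close> by dominated
  convergence.

  The subsequence is chosen so that the labels settle at every point of a countable dense set
  \<open>D\<close>. Convexity propagates this: on the convex hull of the points of \<open>D\<close> whose label settles to
  \<open>i\<close>, the label also settles to \<open>i\<close>. There are finitely many such hulls, so their closures cover
  the space, and the points outside all hulls lie on the boundaries of finitely many convex sets,
  which is a Lebesgue null set.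

  On that null set the subsequence need not converge, but the limit still has to be a partition of
  the whole space into convex Borel cells. Any cluster point of the subsequence in the product
  topology (Tychonoff) provides a labelling everywhere, and its fibres are convex because
  convexity of a fibre constrains only three points at a time. Its fibres are automatically Borel:
  although a single convex set need not be Borel, the members of a finite partition into convex
  sets are separated pairwise by hyperplanes, so off these hyperplanes each cell is an intersection
  of open half-spaces, and inside each hyperplane the argument repeats in lower dimension
  (\<open>convex_fibres_borel\<close>).
\<close>

section \<open>Pointwise subsequences and cluster points of labellings\<close>

lemma compact_finite_valued_functions:
  assumes "finite (K :: 'b::topological_space set)"
  shows "compact {f :: 'a \<Rightarrow> 'b. \<forall>x. f x \<in> K}"
proof -
  have "{f :: 'a \<Rightarrow> 'b. \<forall>x. f x \<in> K} = PiE UNIV (\<lambda>_. K)"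
    by (auto simp: PiE_def)
  moreover have "compactin (product_topology (\<lambda>_::'a. euclidean) UNIV) (PiE UNIV (\<lambda>_. K))"
    unfolding compactin_PiE using assms by (simp add: finite_imp_compact)
  ultimately show ?thesis
    by (simp add: euclidean_product_topology)
qed

lemma open_cylinder:
  fixes f :: "'a \<Rightarrow> 'b::discrete_topology"
  assumes "finite F"
  shows "open {h. \<forall>x\<in>F. h x = f x}"
proof -
  have "open {h :: 'a \<Rightarrow> 'b. h x = f x}" for x
    using open_vimage[OF discrete_topology_class.open_discrete[of "{f x}"] continuous_on_product_coordinates[of x]]
    by (simp add: vimage_def)
  then have "open (\<Inter>x\<in>F. {h :: 'a \<Rightarrow> 'b. h x = f x})"
    using assms by (intro open_INT) auto
  moreover have "(\<Inter>x\<in>F. {h. h x = f x}) = {h. \<forall>x\<in>F. h x = f x}"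
    by auto
  ultimately show ?thesis by simp
qed

text \<open>
  Compactness of the product space, read off on basic neighbourhoods. The domain may be
  uncountable, so a cluster point need not be the pointwise limit of any subsequence.
\<close>

lemma finite_valued_cluster_point:
  fixes g :: "nat \<Rightarrow> 'a \<Rightarrow> 'b::discrete_topology"
  assumes K: "finite K" and g: "\<And>k x. g k x \<in> K"
  obtains f where "\<And>x. f x \<in> K"
    and "\<And>F. finite F \<Longrightarrow> \<exists>\<^sub>F k in sequentially. \<forall>x\<in>F. g k x = f x"
proof -
  let ?G = "filtermap g sequentially"
  have "?G \<noteq> bot" by (simp add: filtermap_bot_iff)
  moreover have "eventually (\<lambda>h. h \<in> {f. \<forall>x. f x \<in> K}) ?G"
    using g by (simp add: eventually_filtermap)
  ultimately obtain f where f: "\<forall>x. f x \<in> K" and ne: "inf (nhds f) ?G \<noteq> bot"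
    using compact_finite_valued_functions[OF K] unfolding compact_filter by blast
  have "\<exists>\<^sub>F k in sequentially. \<forall>x\<in>F. g k x = f x" if F: "finite F" for F
  proof (rule ccontr)
    assume "\<not> ?thesis"
    then have "eventually (\<lambda>h. \<not> (\<forall>x\<in>F. h x = f x)) ?G"
      unfolding frequently_def eventually_filtermap by simp
    moreover have "eventually (\<lambda>h. \<forall>x\<in>F. h x = f x) (nhds f)"
      using open_cylinder[OF F, of f] unfolding eventually_nhds by blast
    ultimately have "eventually (\<lambda>_. False) (inf (nhds f) ?G)"
      unfolding eventually_inf by blast
    then show False using ne by (simp add: trivial_limit_def)
  qed
  with f that show ?thesis by blast
qed

text \<open>
  Over a countable index set the product is first countable, so there compactness does give a
  convergent subsequence, without a separate diagonal argument.
\<close>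

lemma finite_valued_subsequence_on_countable:
  fixes g :: "nat \<Rightarrow> 'a \<Rightarrow> 'b::{discrete_topology,first_countable_topology}"
  assumes D: "countable D" and K: "finite K" and g: "\<And>k x. g k x \<in> K"
  obtains r :: "nat \<Rightarrow> nat" where "strict_mono r"
    and "\<And>d. d \<in> D \<Longrightarrow> \<exists>c. \<forall>\<^sub>F k in sequentially. g (r k) d = c"
proof -
  have compact: "seq_compact {h :: nat \<Rightarrow> 'b. \<forall>x. h x \<in> K}"
    by (intro compact_imp_seq_compact compact_finite_valued_functions K)
  have mem: "\<forall>k. (\<lambda>n. g k (from_nat_into D n)) \<in> {h. \<forall>x. h x \<in> K}"
    using g by simp
  obtain l r where r: "strict_mono r"
    and l: "((\<lambda>k n. g k (from_nat_into D n)) \<circ> r) \<longlonglongrightarrow> l"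
    by (rule seq_compactE[OF compact mem], rule that)
  have "\<exists>c. \<forall>\<^sub>F k in sequentially. g (r k) d = c" if d: "d \<in> D" for d
  proof -
    let ?n = "to_nat_on D d"
    have op: "open {h. \<forall>n\<in>{?n}. h n = l n}" by (rule open_cylinder) simp
    have "\<forall>\<^sub>F k in sequentially. ((\<lambda>k n. g k (from_nat_into D n)) \<circ> r) k \<in> {h. \<forall>n\<in>{?n}. h n = l n}"
      by (rule topological_tendstoD[OF l op]) simp
    then show ?thesis using d D by auto
  qed
  with r that show ?thesis by blast
qed

section \<open>Borel measurability of finite convex partitions\<close>

text \<open>
  Separation relative to the affine span of the two sets: the separating hyperplane does not contain
  both of them, even when they lie in a common proper affine subspace. Taking the normal vector in
  the span of the differences achieves this, since a nonzero vector is not orthogonal to itself.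
\<close>

lemma separating_hyperplane_proper:
  fixes S T :: "'a::euclidean_space set"
  assumes S: "convex S" "S \<noteq> {}" and T: "convex T" "T \<noteq> {}" and disj: "S \<inter> T = {}"
  obtains a b where "\<And>x. x \<in> S \<Longrightarrow> a \<bullet> x \<le> b" "\<And>y. y \<in> T \<Longrightarrow> b \<le> a \<bullet> y"
    "\<not> S \<union> T \<subseteq> {x. a \<bullet> x = b}"
proof -
  let ?D = "\<Union>y\<in>T. \<Union>x\<in>S. {y - x}"
  have D: "convex ?D" using convex_differences[OF T(1) S(1)] .
  have ne: "?D \<noteq> {}" using S(2) T(2) by blast
  have 0: "0 \<notin> ?D" using disj by auto
  obtain a where a: "a \<in> span ?D" "a \<noteq> 0" "\<And>z. z \<in> ?D \<Longrightarrow> 0 \<le> a \<bullet> z"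
    by (rule separating_hyperplane_set_0_inspan[OF D ne 0], rule that)
  have le: "a \<bullet> x \<le> a \<bullet> y" if "x \<in> S" "y \<in> T" for x y
    using a(3)[of "y - x"] that by (auto simp: inner_diff_right)
  \<comment> \<open>Every value between the supremum over \<open>S\<close> and the infimum over \<open>T\<close> would serve as offset.\<close>
  let ?b = "SUP x\<in>S. a \<bullet> x"
  have bdd: "bdd_above ((\<bullet>) a ` S)"
    using le T(2) by (meson bdd_aboveI2 ex_in_conv)
  have 1: "a \<bullet> x \<le> ?b" if "x \<in> S" for x
    using that bdd by (rule cSUP_upper)
  have 2: "?b \<le> a \<bullet> y" if "y \<in> T" for y
    using le that by (intro cSUP_least S(2)) auto
  have 3: "\<not> S \<union> T \<subseteq> {x. a \<bullet> x = ?b}"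
  proof
    assume "S \<union> T \<subseteq> {x. a \<bullet> x = ?b}"
    then have "orthogonal a z" if "z \<in> ?D" for z
      using that by (auto simp: orthogonal_def inner_diff_right subset_iff)
    then have "orthogonal a a" by (rule orthogonal_to_span[OF a(1)])
    then show False using a(2) by (simp add: orthogonal_self)
  qed
  from 1 2 3 that show ?thesis by blast
qed

text \<open>
  Induction on the dimension of the affine set \<open>A\<close>. A fibre of \<open>f\<close> in \<open>A\<close> consists of the points
  strictly on its own side of all hyperplanes that separate it from the other fibres, together
  with its points on these hyperplanes. Each hyperplane cuts \<open>A\<close> in an affine set of smaller
  dimension, where the fibres again form a partition into convex sets.
\<close>

lemma convex_fibres_borel_in_affine:
  fixes f :: "'a::euclidean_space \<Rightarrow> 'b"
  assumes fin: "finite (range f)" and conv: "\<And>i. convex (f -` {i})" and "affine A"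
  shows "f -` {i} \<inter> A \<in> sets borel"
  using \<open>affine A\<close>
  \<comment> \<open>The shift by one keeps the empty set, of dimension \<open>-1\<close>, below the points.\<close>
proof (induction "nat (aff_dim A + 1)" arbitrary: A i rule: less_induct)
  case less
  define J where "J = f ` A - {i}"
  have finJ: "finite J" unfolding J_def using fin by (meson finite_Diff finite_subset image_mono subset_UNIV)
  have convA: "convex A" using less.prems by (rule affine_imp_convex)
  show ?case
  proof (cases "f -` {i} \<inter> A = {}")
    case False
    have "\<exists>a b. (\<forall>x\<in>f -` {i} \<inter> A. a \<bullet> x \<le> b) \<and> (\<forall>y\<in>f -` {j} \<inter> A. b \<le> a \<bullet> y)
            \<and> \<not> A \<subseteq> {x. a \<bullet> x = b}" if j: "j \<in> J" for j
    proof -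
      have ne: "f -` {j} \<inter> A \<noteq> {}" and disj: "(f -` {i} \<inter> A) \<inter> (f -` {j} \<inter> A) = {}"
        using j by (auto simp: J_def)
      show ?thesis
        by (rule separating_hyperplane_proper[OF convex_Int[OF conv convA] False
              convex_Int[OF conv convA] ne disj]) blast
    qed
    then obtain a b where
      le: "\<And>j x. j \<in> J \<Longrightarrow> x \<in> f -` {i} \<inter> A \<Longrightarrow> a j \<bullet> x \<le> b j" and
      ge: "\<And>j x. j \<in> J \<Longrightarrow> x \<in> f -` {j} \<inter> A \<Longrightarrow> b j \<le> a j \<bullet> x" and
      proper: "\<And>j. j \<in> J \<Longrightarrow> \<not> A \<subseteq> {x. a j \<bullet> x = b j}"
      by metis
    define U where "U = (\<Inter>j\<in>J. {x. a j \<bullet> x < b j})"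
    \<comment> \<open>A point of \<open>A\<close> strictly on the near side of every hyperplane cannot have any other label.\<close>
    have "f -` {i} \<inter> A = (A \<inter> U) \<union> (\<Union>j\<in>J. f -` {i} \<inter> ({x. a j \<bullet> x = b j} \<inter> A))" (is "_ = ?R")
    proof
      show "f -` {i} \<inter> A \<subseteq> ?R"
        using le by (fastforce simp: U_def)
      have "f x = i" if "x \<in> A \<inter> U" for x
      proof (rule ccontr)
        assume "f x \<noteq> i"
        then have "f x \<in> J" using that by (auto simp: J_def)
        then show False using ge[of "f x" x] that by (auto simp: U_def)
      qed
      then show "?R \<subseteq> f -` {i} \<inter> A" by blast
    qed
    moreover have "A \<in> sets borel"
      using less.prems by (intro borel_closed affine_closed)
    moreover have "U \<in> sets borel"
      unfolding U_def using finJ by (intro borel_open open_INT) (auto simp: open_halfspace_lt)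
    moreover have "f -` {i} \<inter> ({x. a j \<bullet> x = b j} \<inter> A) \<in> sets borel" if j: "j \<in> J" for j
    proof (rule less.hyps)
      show aff: "affine ({x. a j \<bullet> x = b j} \<inter> A)"
        using affine_hyperplane less.prems by (rule affine_Int)
      have "affine hull ({x. a j \<bullet> x = b j} \<inter> A) \<subset> affine hull A"
        using proper[OF j] aff less.prems by (auto simp: hull_same)
      then have "aff_dim ({x. a j \<bullet> x = b j} \<inter> A) < aff_dim A"
        by (rule aff_dim_psubset)
      then show "nat (aff_dim ({x. a j \<bullet> x = b j} \<inter> A) + 1) < nat (aff_dim A + 1)"
        using aff_dim_geq[of "{x. a j \<bullet> x = b j} \<inter> A"] by linarith
    qed
    ultimately show ?thesis using finJ by (metis (no_types, lifting) sets.Int sets.Un sets.finite_UN)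
  qed simp
qed

lemma convex_fibres_borel:
  fixes f :: "'a::euclidean_space \<Rightarrow> 'b"
  assumes "finite (range f)" "\<And>i. convex (f -` {i})"
  shows "f -` {i} \<in> sets borel"
  using convex_fibres_borel_in_affine[OF assms affine_UNIV] by simp

section \<open>Almost everywhere convergence of labellings with convex fibres\<close>

text \<open>
  A point of the hull is a convex combination of finitely many points of \<open>S\<close>, and finitely many
  eventual statements hold simultaneously.
\<close>

lemma eventually_constant_on_convex_hull:
  fixes g :: "nat \<Rightarrow> 'a::euclidean_space \<Rightarrow> 'b"
  assumes conv: "\<And>k. convex (g k -` {i})"
    and S: "\<And>d. d \<in> S \<Longrightarrow> \<forall>\<^sub>F k in sequentially. g k d = i"
    and x: "x \<in> convex hull S"
  shows "\<forall>\<^sub>F k in sequentially. g k x = i"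
proof -
  obtain T where T: "finite T" "T \<subseteq> S" "x \<in> convex hull T"
    using x caratheodory_aff_dim[of S] by blast
  have "\<forall>\<^sub>F k in sequentially. \<forall>d\<in>T. g k d = i"
    using T(1,2) S by (auto simp: eventually_ball_finite_distrib)
  then show ?thesis
  proof eventually_elim
    case (elim k)
    then have "convex hull T \<subseteq> g k -` {i}"
      by (intro hull_minimal conv) auto
    then show ?case using T(3) by auto
  qed
qed

text \<open>
  If convexity failed for \<open>f\<close>, it would fail at two endpoints and a point between them, and some
  \<open>g k\<close> agrees with \<open>f\<close> at these three points.
\<close>

lemma convex_fibres_cluster_point:
  fixes g :: "nat \<Rightarrow> 'a::real_vector \<Rightarrow> 'b"
  assumes conv: "\<And>k i. convex (g k -` {i})"
    and cl: "\<And>F. finite F \<Longrightarrow> \<exists>\<^sub>F k in sequentially. \<forall>x\<in>F. g k x = f x"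
  shows "convex (f -` {i})"
proof (rule convexI)
  fix x y and u v :: real
  assume xy: "x \<in> f -` {i}" "y \<in> f -` {i}" and uv: "0 \<le> u" "0 \<le> v" "u + v = 1"
  let ?z = "u *\<^sub>R x + v *\<^sub>R y"
  obtain k where k: "\<forall>w\<in>{x, y, ?z}. g k w = f w"
    using cl[of "{x, y, ?z}"] by (auto dest: frequently_ex)
  then have "?z \<in> g k -` {i}"
    using convexD[OF conv[of k i], of x y u v] xy uv by auto
  then show "?z \<in> f -` {i}" using k by auto
qed

text \<open>
  The limit is a cluster point of a subsequence that already converges on a dense set, hence it
  agrees with the limit there. Almost every point is covered by the convex hull of
  the dense points of one label, since the exceptional points lie on the boundaries of these hulls.
\<close>

lemma convex_fibres_subsequence_converges_AE:
  fixes g :: "nat \<Rightarrow> 'a::euclidean_space \<Rightarrow> nat"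
  assumes K: "finite K" and g: "\<And>k x. g k x \<in> K" and conv: "\<And>k i. convex (g k -` {i})"
  obtains r f where "strict_mono (r :: nat \<Rightarrow> nat)" "\<And>x. f x \<in> K" "\<And>i. convex (f -` {i})"
    "AE x in lborel. \<forall>\<^sub>F k in sequentially. g (r k) x = f x"
proof -
  obtain D :: "'a set" where D: "countable D" "\<And>X. open X \<Longrightarrow> X \<noteq> {} \<Longrightarrow> \<exists>d\<in>D. d \<in> X"
    by (rule countable_dense_setE, rule that)
  obtain r where r: "strict_mono r"
    and rD: "\<And>d. d \<in> D \<Longrightarrow> \<exists>c. \<forall>\<^sub>F k in sequentially. g (r k) d = c"
    by (rule finite_valued_subsequence_on_countable[OF D(1) K g], rule that)
  obtain f where fK: "\<And>x. f x \<in> K"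
    and cl: "\<And>F. finite F \<Longrightarrow> \<exists>\<^sub>F k in sequentially. \<forall>x\<in>F. g (r k) x = f x"
    by (rule finite_valued_cluster_point[where g = "\<lambda>k. g (r k)", OF K g], rule that)
  have fconv: "convex (f -` {i})" for i
    by (rule convex_fibres_cluster_point[of "\<lambda>k. g (r k)"]) (use conv cl in auto)
  have fD: "\<forall>\<^sub>F k in sequentially. g (r k) d = f d" if "d \<in> D" for d
  proof -
    obtain c where c: "\<forall>\<^sub>F k in sequentially. g (r k) d = c" using rD \<open>d \<in> D\<close> by blast
    have "\<exists>\<^sub>F k in sequentially. g (r k) d = f d" using cl[of "{d}"] by simp
    from frequently_ex[OF frequently_eventually_frequently[OF this c]]
    have "c = f d" by auto
    then show ?thesis using c by simp
  qed
  define H where "H i = convex hull (D \<inter> f -` {i})" for i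
  have H_conv: "\<forall>\<^sub>F k in sequentially. g (r k) x = f x" if "x \<in> H i" for x i
  proof -
    have "H i \<subseteq> f -` {i}" unfolding H_def by (intro hull_minimal fconv) auto
    moreover have "\<forall>\<^sub>F k in sequentially. g (r k) x = i"
      by (rule eventually_constant_on_convex_hull[where g = "\<lambda>k. g (r k)" and S = "D \<inter> f -` {i}"])
         (use conv fD that in \<open>auto simp: H_def\<close>)
    ultimately show ?thesis using that by auto
  qed
  have dense: "(\<Union>i\<in>K. closure (H i)) = UNIV"
  proof -
    have "D \<subseteq> (\<Union>i\<in>K. H i)"
      unfolding H_def using fK by (auto intro!: hull_inc)
    then have "closure D \<subseteq> (\<Union>i\<in>K. closure (H i))"
    proof (intro closure_minimal closed_UN K)
      have "(\<Union>i\<in>K. H i) \<subseteq> (\<Union>i\<in>K. closure (H i))"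
        by (intro UN_mono subset_refl closure_subset)
      then show "D \<subseteq> (\<Union>i\<in>K. closure (H i))" using \<open>D \<subseteq> _\<close> by (rule subset_trans[rotated])
    qed simp
    moreover have "closure D = UNIV"
    proof -
      have "- closure D = {}"
      proof (rule ccontr)
        assume "- closure D \<noteq> {}"
        then obtain d where "d \<in> D" "d \<in> - closure D" using D(2)[of "- closure D"] by auto
        then show False using closure_subset by auto
      qed
      then show ?thesis by auto
    qed
    ultimately show ?thesis by auto
  qed
  have null: "(\<Union>i\<in>K. frontier (H i)) \<in> null_sets lborel"
  proof (intro null_sets.finite_UN K)
    fix i
    have "frontier (H i) \<in> null_sets (completion lborel)"
      unfolding H_def by (metis negligible_convex_frontier negligible_iff_null_sets convex_convex_hull)
    then show "frontier (H i) \<in> null_sets lborel"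
      by (simp add: null_sets_completion_iff borel_closed)
  qed
  have "AE x in lborel. \<forall>\<^sub>F k in sequentially. g (r k) x = f x"
  proof (rule AE_I'[OF null], safe)
    fix x assume x: "\<not> (\<forall>\<^sub>F k in sequentially. g (r k) x = f x)"
    obtain i where i: "i \<in> K" "x \<in> closure (H i)" using dense by blast
    have "x \<notin> H i" using H_conv x by blast
    then have "x \<in> frontier (H i)"
      using i(2) interior_subset by (auto simp: frontier_def)
    then show "x \<in> (\<Union>i\<in>K. frontier (H i))" using i(1) by blast
  qed
  with r fK fconv that show ?thesis by blast
qed

section \<open>Quantizers as labellings\<close>

definition cell_index :: "nat \<Rightarrow> (nat \<Rightarrow> 'a set) \<Rightarrow> 'a \<Rightarrow> nat" where
  "cell_index M B x = (THE i. i \<in> {1..M} \<and> x \<in> B i)"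

lemma cell_index_eq_iff:
  fixes B :: "nat \<Rightarrow> 'a::topological_space set"
  assumes "quantizer_partition M B" "i \<in> {1..M}"
  shows "cell_index M B x = i \<longleftrightarrow> x \<in> B i"
proof -
  have "\<exists>!i. i \<in> {1..M} \<and> x \<in> B i"
    using assms(1) unfolding quantizer_partition_def disjoint_family_on_def by blast
  then show ?thesis
    unfolding cell_index_def using assms(2) by (metis (no_types, lifting) theI')
qed

lemma cell_index_mem:
  fixes B :: "nat \<Rightarrow> 'a::topological_space set"
  assumes "quantizer_partition M B"
  shows "cell_index M B x \<in> {1..M}"
proof -
  obtain i where "i \<in> {1..M}" "x \<in> B i"
    using assms unfolding quantizer_partition_def by blast
  then show ?thesis using cell_index_eq_iff[OF assms] by metis
qed

lemma measurable_cell_index: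
  fixes B :: "nat \<Rightarrow> 'a::topological_space set"
  assumes "quantizer_partition M B"
  shows "cell_index M B \<in> borel \<rightarrow>\<^sub>M count_space {1..M}"
proof -
  have "cell_index M B -` {i} = B i" if "i \<in> {1..M}" for i
    using cell_index_eq_iff[OF assms that] by auto
  then show ?thesis
    using assms cell_index_mem[OF assms]
    by (subst measurable_count_space_eq2) (auto simp: quantizer_partition_def)
qed

lemma quantizer_kernel_eq_return:
  fixes B :: "nat \<Rightarrow> 'a::topological_space set"
  assumes "quantizer_partition M B"
  shows "quantizer_kernel M B x = return (count_space {1..M}) (cell_index M B x)"
proof (rule measure_eqI_finite[where A = "{1..M}"])
  fix i assume "i \<in> {1..M}"
  then show "emeasure (quantizer_kernel M B x) {i}
      = emeasure (return (count_space {1..M}) (cell_index M B x)) {i}"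
    using cell_index_eq_iff[OF assms, of i x]
    by (simp add: emeasure_quantizer_kernel indicator_def)
qed (auto simp: quantizer_kernel_def sets_point_measure)

text \<open>
  A quantizer is deterministic, so the monadic definition of the joint law collapses to the image
  of the input law under the graph of the labelling. Events of the joint law can then be compared
  through their preimages in the input space.
\<close>

lemma joint_law_quantizer:
  fixes P :: "'a::topological_space measure"
  assumes B: "quantizer_partition M B" and P: "sets P = sets borel"
  shows "joint_law M P (quantizer_kernel M B)
    = distr P (borel \<Otimes>\<^sub>M count_space {1..M}) (\<lambda>x. (x, cell_index M B x))"
proof -
  let ?N = "borel \<Otimes>\<^sub>M count_space {1..M} :: ('a \<times> nat) measure"
  have "quantizer_kernel M B x \<bind> (\<lambda>i. return ?N (x, i)) = return ?N (x, cell_index M B x)" for x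
  proof -
    have "(\<lambda>i. return ?N (x, i)) \<in> count_space {1..M} \<rightarrow>\<^sub>M subprob_algebra ?N"
      by (rule measurable_compose[OF measurable_Pair1' return_measurable]) simp
    then show ?thesis
      unfolding quantizer_kernel_eq_return[OF B]
      by (rule bind_return) (use cell_index_mem[OF B] in simp)
  qed
  then have "joint_law M P (quantizer_kernel M B)
      = P \<bind> (\<lambda>x. return ?N (x, cell_index M B x))"
    unfolding joint_law_def by simp
  also have "\<dots> = distr P ?N (\<lambda>x. (x, cell_index M B x))"
  proof (rule bind_return_distr')
    show "space P \<noteq> {}" using sets_eq_imp_space_eq[OF P] by simp
    show "(\<lambda>x. (x, cell_index M B x)) \<in> P \<rightarrow>\<^sub>M ?N"
      unfolding measurable_cong_sets[OF P refl]
      by (intro measurable_Pair measurable_ident_sets refl measurable_cell_index B)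
  qed
  finally show ?thesis .
qed

section \<open>Total variation and disagreement of labels\<close>

lemma disagreement_set_borel:
  fixes B C :: "nat \<Rightarrow> 'a::topological_space set"
  assumes B: "quantizer_partition M B" and C: "quantizer_partition M C"
  shows "{x. cell_index M B x \<noteq> cell_index M C x} \<in> sets borel"
proof -
  have "{x. cell_index M B x \<noteq> cell_index M C x} = UNIV - (\<Union>i\<in>{1..M}. B i \<inter> C i)" (is "?E = ?R")
  proof -
    have "cell_index M B x = cell_index M C x \<longleftrightarrow> (\<exists>i\<in>{1..M}. x \<in> B i \<and> x \<in> C i)" for x
      using cell_index_mem[OF B, of x] cell_index_eq_iff[OF B, of _ x] cell_index_eq_iff[OF C, of _ x]
      by metis
    then show ?thesis by blast
  qed
  also have "?R \<in> sets borel"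
    using B C by (intro sets.Diff sets.finite_UN) (auto simp: quantizer_partition_def)
  finally show ?thesis .
qed

text \<open>
  The preimages of an event under the two graphs differ only where the labels disagree. The lower
  bound is not immediate, because the supremum of real numbers is meaningful only after it is known
  to be bounded, which the same estimate provides.
\<close>

lemma tv_distance_joint_law_bounds:
  fixes P :: "'a::topological_space measure"
  assumes P: "prob_space P" "sets P = sets borel"
    and B: "quantizer_partition M B" and C: "quantizer_partition M C"
  defines "T \<equiv> tv_distance (joint_law M P (quantizer_kernel M B)) (joint_law M P (quantizer_kernel M C))"
  shows "0 \<le> T" and "T \<le> 2 * measure P {x. cell_index M B x \<noteq> cell_index M C x}"
proof -
  interpret prob_space P by fact
  let ?N = "borel \<Otimes>\<^sub>M count_space {1..M} :: ('a \<times> nat) measure"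
  let ?\<mu> = "joint_law M P (quantizer_kernel M B)" and ?\<nu> = "joint_law M P (quantizer_kernel M C)"
  let ?E = "{x. cell_index M B x \<noteq> cell_index M C x}"
  have spP: "space P = UNIV" using sets_eq_imp_space_eq[OF P(2)] by simp
  have sets\<mu>: "sets ?\<mu> = sets ?N" by (simp only: joint_law_quantizer[OF B P(2)] sets_distr)
  have idx: "cell_index M B' \<in> P \<rightarrow>\<^sub>M count_space {1..M}" if "quantizer_partition M B'" for B'
    using measurable_cell_index[OF that] by (simp add: measurable_cong_sets[OF P(2) refl])
  have pair: "(\<lambda>x. (x, cell_index M B' x)) \<in> P \<rightarrow>\<^sub>M ?N" if "quantizer_partition M B'" for B'
    using P(2) by (intro measurable_Pair idx that measurable_ident_sets)
  have E: "?E \<in> sets P"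
    using disagreement_set_borel[OF B C] P(2) by simp
  have le: "\<bar>measure ?\<mu> A - measure ?\<nu> A\<bar> \<le> measure P ?E" if A: "A \<in> sets ?\<mu>" for A
  proof -
    define V where "V B' = (\<lambda>x. (x, cell_index M B' x)) -` A \<inter> space P" for B'
    have V: "V B' \<in> sets P" if "quantizer_partition M B'" for B'
      unfolding V_def using measurable_sets[OF pair[OF that]] A sets\<mu> by simp
    have eq: "measure (joint_law M P (quantizer_kernel M B')) A = measure P (V B')"
      if "quantizer_partition M B'" for B'
      using A sets\<mu> unfolding joint_law_quantizer[OF that P(2)] V_def
      by (intro measure_distr pair that) blast
    have sub: "measure P (V B') \<le> measure P (V C') + measure P ?E"
      if "V B' \<subseteq> V C' \<union> ?E" "quantizer_partition M C'" for B' C'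
    proof -
      have "measure P (V B') \<le> measure P (V C' \<union> ?E)"
        using that V E by (intro finite_measure_mono) auto
      also have "\<dots> \<le> measure P (V C') + measure P ?E"
        using that V E by (intro measure_Un_le) auto
      finally show ?thesis .
    qed
    have "V B \<subseteq> V C \<union> ?E" "V C \<subseteq> V B \<union> ?E" by (auto simp: V_def)
    then show ?thesis
      using sub[of B C] sub[of C B] B C unfolding eq[OF B] eq[OF C] by linarith
  qed
  have bdd: "bdd_above ((\<lambda>A. \<bar>measure ?\<mu> A - measure ?\<nu> A\<bar>) ` sets ?\<mu>)"
    using le by (rule bdd_aboveI2)
  show "T \<le> 2 * measure P ?E"
    unfolding T_def tv_distance_def 
    by (intro mult_left_mono cSUP_least le) (use sets.top in \<open>blast | simp\<close>)+
  have "0 \<le> (SUP A\<in>sets ?\<mu>. \<bar>measure ?\<mu> A - measure ?\<nu> A\<bar>)"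
    by (rule cSUP_upper2[OF bdd sets.empty_sets]) simp
  then show "0 \<le> T" by (simp add: T_def tv_distance_def)
qed

lemma (in prob_space) prob_disagreement_tendsto_0:
  assumes "\<And>k. {x\<in>space M. g k x \<noteq> f x} \<in> events"
    and "AE x in M. \<forall>\<^sub>F k in sequentially. g k x = f x"
  shows "(\<lambda>k. prob {x\<in>space M. g k x \<noteq> f x}) \<longlonglongrightarrow> 0"
proof -
  let ?E = "\<lambda>k. {x\<in>space M. g k x \<noteq> f x}"
  have "(\<lambda>k. integral\<^sup>L M (indicator (?E k) :: _ \<Rightarrow> real)) \<longlonglongrightarrow> integral\<^sup>L M (\<lambda>_. 0 :: real)"
  proof (rule integral_dominated_convergence[where w = "\<lambda>_. 1"])
    show "AE x in M. (\<lambda>k. indicator (?E k) x :: real) \<longlonglongrightarrow> 0"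
      using assms(2)
    proof eventually_elim
      case (elim x)
      then show ?case
        by (intro tendsto_eventually) (auto elim: eventually_mono simp: indicator_def)
    qed
    show "AE x in M. norm (indicator (?E k) x :: real) \<le> 1" for k
      by (simp add: indicator_def)
  qed (use assms(1) in \<open>intro borel_measurable_const borel_measurable_indicator integrable_const; assumption\<close>)+
  moreover have "integral\<^sup>L M (indicator (?E k) :: _ \<Rightarrow> real) = prob (?E k)" for k
    using assms(1)[of k, THEN sets.sets_into_space] by (simp add: Int_absorb2)
  ultimately show ?thesis by simp
qed

theorem theorem5p8:
  fixes P :: "(real ^ 'n) measure" and M :: nat
  assumes "M \<ge> 1"
    and "prob_space P" and "sets P = sets borel"
    and "absolutely_continuous lborel P"
  shows "tv_compact_at M P (convex_quantizers M)"
  unfolding tv_compact_at_def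
proof (intro allI impI)
  interpret prob_space P by fact
  have spP: "space P = UNIV" using sets_eq_imp_space_eq[OF assms(3)] by simp
  fix Qs :: "nat \<Rightarrow> real ^ 'n \<Rightarrow> nat measure"
  assume "\<forall>k. Qs k \<in> convex_quantizers M"
  then have "\<forall>k. \<exists>B. Qs k = quantizer_kernel M B \<and> quantizer_partition M B \<and> (\<forall>i\<in>{1..M}. convex (B i))"
    unfolding convex_quantizers_def by blast
  then obtain B where Qs: "\<And>k. Qs k = quantizer_kernel M (B k)"
    and B: "\<And>k. quantizer_partition M (B k)" and convB: "\<And>k i. i \<in> {1..M} \<Longrightarrow> convex (B k i)"
    by metis
  define g where "g k = cell_index M (B k)" for k
  have gK: "g k x \<in> {1..M}" for k x
    unfolding g_def by (rule cell_index_mem[OF B])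
  have gconv: "convex (g k -` {i})" for k i
  proof (cases "i \<in> {1..M}")
    case True
    then have "g k -` {i} = B k i"
      using cell_index_eq_iff[OF B True] by (auto simp: g_def)
    then show ?thesis using convB True by simp
  next
    case False
    then have "g k -` {i} = {}" using gK by auto
    then show ?thesis by simp
  qed
  obtain r f where r: "strict_mono r" and fK: "\<And>x. f x \<in> {1..M}"
    and fconv: "\<And>i. convex (f -` {i})"
    and ae: "AE x in lborel. \<forall>\<^sub>F k in sequentially. g (r k) x = f x"
    by (rule convex_fibres_subsequence_converges_AE[OF finite_atLeastAtMost gK gconv], rule that)
  define C where "C i = f -` {i}" for i
  have borelC: "C i \<in> sets borel" for i
    unfolding C_def
    by (rule convex_fibres_borel[OF finite_subset[of _ "{1..M}"] fconv]) (use fK in auto)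
  have C: "quantizer_partition M C"
    unfolding quantizer_partition_def using borelC fK
    by (auto simp: C_def disjoint_family_on_def)
  have idxC: "cell_index M C x = f x" for x
    using cell_index_eq_iff[OF C fK] by (simp add: C_def)
  have "quantizer_kernel M C \<in> convex_quantizers M"
    unfolding convex_quantizers_def using C fconv by (auto simp: C_def)
  moreover have "tv_converges_at M P (Qs \<circ> r) (quantizer_kernel M C)"
  proof -
    let ?E = "\<lambda>k. {x \<in> space P. g (r k) x \<noteq> f x}"
    have "?E k \<in> events" for k
      using disagreement_set_borel[OF B[of "r k"] C] assms(3) by (simp add: idxC g_def spP)
    moreover have "AE x in P. \<forall>\<^sub>F k in sequentially. g (r k) x = f x"
      using assms(4) ae by (intro absolutely_continuous_AE[of P lborel]) (use assms(3) in simp_all)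
    ultimately have "(\<lambda>k. 2 * prob (?E k)) \<longlonglongrightarrow> 2 * 0"
      by (intro tendsto_mult tendsto_const prob_disagreement_tendsto_0)
    then have lim: "(\<lambda>k. 2 * prob {x. cell_index M (B (r k)) x \<noteq> cell_index M C x}) \<longlonglongrightarrow> 0"
      by (simp add: spP idxC g_def)
    show ?thesis
      unfolding tv_converges_at_def comp_def Qs
      by (rule real_tendsto_sandwich[OF _ _ tendsto_const lim])
         (auto intro!: always_eventually tv_distance_joint_law_bounds[OF assms(2,3) B C])
  qed
  ultimately show "\<exists>Q\<in>convex_quantizers M. \<exists>r. strict_mono r \<and> tv_converges_at M P (Qs \<circ> r) Q"
    using r by blast
qed

end
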